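(* Let $k\ge 2$ and $n \ge 2k+1$ be integers, and let $H$ be a $k$-uniform hypergraph on $n$ vertices. If every vertex of $H$ has degree at least $\binom{n-2}{k-2}$, then either $H$ is a $1$-star, or $H$ contains two disjoint edges.
   Context: A $k$-uniform hypergraph $H$ consists of a finite vertex set $V(H)$ and an edge set $E(H)$, which is a set of $k$-element subsets of $V(H)$. The degree of a vertex $v$ is the number of edges of $H$ containing $v$. A $k$-uniform hypergraph $H$ on $n$ vertices is called a $1$-star if there is a vertex $v\in V(H)$ such that $E(H)$ consists of exactly all $k$-element subsets of $V(H)$ that contain $v$. *)

theory Defs
  imports Complex_Main
begin

definition uniform_hypergraph :: "nat \<Rightarrow> 'a set \<Rightarrow> 'a set set \<Rightarrow> bool" where
  "uniform_hypergraph k V E \<longleftrightarrow> finite V \<and> (\<forall>e\<in>E. e \<subseteq> V \<and> card e = k)"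

definition vertex_degree :: "'a set set \<Rightarrow> 'a \<Rightarrow> nat" where
  "vertex_degree E v = card {e \<in> E. v \<in> e}"

definition one_star :: "nat \<Rightarrow> 'a set \<Rightarrow> 'a set set \<Rightarrow> bool" where
  "one_star k V E \<longleftrightarrow> (\<exists>v\<in>V. E = {e. e \<subseteq> V \<and> card e = k \<and> v \<in> e})"

end

theory Submission
  imports Defs "HOL-Analysis.Function_Topology"
begin

text \<open>
Suppose that no two edges are disjoint. Write \<open>m\<close> for the number of edges,
\<open>\<delta> = (n-2 choose k-2)\<close> for the lower bound on the degrees and \<open>M = (n-1 choose k-1)\<close> for the
number of \<open>k\<close>-sets through a vertex, so that every degree \<open>d v\<close> lies between \<open>\<delta>\<close> and \<open>M\<close>.
The proof is spectral. It rests on an inequality for intersecting families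
(\<open>intersecting_degree_square_bound\<close>):

  \<open>n (k-1) / (n-1) * m\<^sup>2 \<le> (\<Sum>v. (d v)\<^sup>2) + (k-2) * (M-\<delta>) * m\<close>.

Expanding \<open>\<Sum>v. (d v - \<delta>) * (M - d v)\<close>, which is nonnegative, with \<open>\<Sum>v. d v = k * m\<close> turns
this inequality into

  \<open>(\<Sum>v. (d v - \<delta>) * (M - d v)) + n (k-1) / (n-1) * (m - M)\<^sup>2 \<le> 0\<close>.

So \<open>m = M\<close> and every degree is \<open>\<delta>\<close> or \<open>M\<close>. The degrees sum to \<open>k * M > n * \<delta>\<close>, so some
vertex has degree \<open>M = m\<close>: it lies in every edge, and every \<open>k\<close>-set through it is an edge.

The inequality says that the quadratic form of the symmetric kernel

  \<open>K F G = s * [F \<inter> G = {}] + \<mu> * [F = G] + |F \<inter> G| + c\<close>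

is nonnegative at the indicator of the family, where the first term vanishes. The form is
positive semidefinite. Otherwise a minimiser on the unit sphere would be an eigenvector with
a negative eigenvalue (\<open>negative_form_has_negative_eigenvector\<close>). The difference
\<open>f (S \<union> {x}) - f (S \<union> {y})\<close> maps an eigenvector on the \<open>k\<close>-subsets of an \<open>n\<close>-set to an
eigenvector, with the same eigenvalue, of a simpler kernel on the \<open>(k-1)\<close>-subsets of an
\<open>(n-2)\<close>-set, or kills it (\<open>eigenvector_swap_diff\<close>); and if all these differences vanish, the
eigenvector is constant and the eigenvalue is a row sum (\<open>eigenvalue_cases\<close>). At most three
differences reduce the claim to three row sums and one bound on a spectral radius; no
decomposition of the function space into eigenspaces has to be constructed.

The constants are chosen as follows. The indicator of a star must give equality, and this is
achieved by making the row sums of \<open>K\<close> and of its first difference kernel zero, which determines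
\<open>s\<close> and \<open>c\<close> from \<open>\<mu>\<close>. The remaining freedom in \<open>\<mu>\<close> is used to obtain the perfect square
\<open>(m - M)\<^sup>2\<close> above: for a general \<open>\<mu>\<close> a quadratic in \<open>m\<close> with root \<open>M\<close> stands there, and
\<open>\<mu> = (k-2) * (M-\<delta>)\<close> is the value that makes the root double. The last requirement, on the
third difference, holds for this \<open>\<mu>\<close> because \<open>n \<ge> 2 k + 1\<close>.
\<close>

section \<open>Negative quadratic forms have negative eigenvectors\<close>

definition quad :: "('b \<Rightarrow> 'b \<Rightarrow> real) \<Rightarrow> 'b set \<Rightarrow> ('b \<Rightarrow> real) \<Rightarrow> real" where
  "quad K X f = (\<Sum>x\<in>X. \<Sum>y\<in>X. K x y * f x * f y)"

definition eigenvector :: "('b \<Rightarrow> 'b \<Rightarrow> real) \<Rightarrow> 'b set \<Rightarrow> real \<Rightarrow> ('b \<Rightarrow> real) \<Rightarrow> bool" where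
  "eigenvector K X \<theta> f \<longleftrightarrow> (\<exists>x\<in>X. f x \<noteq> 0) \<and> (\<forall>x\<in>X. (\<Sum>y\<in>X. K x y * f y) = \<theta> * f x)"

lemma sum_of_bool_eq_mult:
  fixes g :: "'b \<Rightarrow> real"
  assumes "finite X" "z \<in> X"
  shows "(\<Sum>y\<in>X. of_bool (z = y) * g y) = g z"
proof -
  have "(\<Sum>y\<in>X. of_bool (z = y) * g y) = (\<Sum>y\<in>X. if z = y then g y else 0)"
    by (intro sum.cong) auto
  then show ?thesis using assms by simp
qed

lemma nonneg_quadratic_imp_linear_coeff_zero:
  fixes u c :: real
  assumes "\<And>t. 0 \<le> 2 * t * u + t\<^sup>2 * c"
  shows "u = 0"
proof (rule ccontr)
  assume "u \<noteq> 0"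
  define d where "d = \<bar>c\<bar> + 1"
  have d: "d > 0" "c < d" by (auto simp: d_def)
  \<comment> \<open>The quadratic would be smallest at \<open>- u / c\<close>; \<open>d\<close> replaces \<open>c\<close> to cover \<open>c \<le> 0\<close>.\<close>
  have "0 \<le> 2 * (- u / d) * u + (- u / d)\<^sup>2 * c" by (rule assms)
  also have "\<dots> = (u / d)\<^sup>2 * (c - 2 * d)"
    using d by (simp add: field_simps power2_eq_square)
  also have "\<dots> < 0"
    using \<open>u \<noteq> 0\<close> d by (intro mult_pos_neg) auto
  finally show False by simp
qed

text \<open>
In a direction \<open>e\<close> the form at \<open>g + t e\<close> is \<open>2 t u + t\<^sup>2 c\<close>, where \<open>u\<close> is the pairing of \<open>K g\<close>
with \<open>e\<close>; nonnegativity for all \<open>t\<close> forces \<open>u = 0\<close>. Taking \<open>e\<close> to be a unit vector reads off one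
coordinate of \<open>K g\<close>.
\<close>

lemma isotropic_imp_null_vector:
  assumes X: "finite X" and sym: "\<And>x y. K x y = K y x"
    and psd: "\<And>f. 0 \<le> quad K X f" and g: "quad K X g = 0" and z: "z \<in> X"
  shows "(\<Sum>y\<in>X. K z y * g y) = 0"
proof (rule nonneg_quadratic_imp_linear_coeff_zero)
  fix t :: real
  let ?e = "\<lambda>x. of_bool (x = z) :: real"
  have row: "(\<Sum>y\<in>X. K x y * ?e y) = K x z" for x
    using X z by (simp add: of_bool_def if_distrib cong: if_cong)
  have "quad K X (\<lambda>x. g x + t * ?e x)
      = quad K X g + t * (\<Sum>x\<in>X. g x * (\<Sum>y\<in>X. K x y * ?e y))
        + t * (\<Sum>x\<in>X. ?e x * (\<Sum>y\<in>X. K x y * g y))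
        + t\<^sup>2 * (\<Sum>x\<in>X. ?e x * (\<Sum>y\<in>X. K x y * ?e y))"
    unfolding quad_def
    by (simp add: algebra_simps sum.distrib sum_distrib_left power2_eq_square)
  also have "(\<Sum>x\<in>X. g x * (\<Sum>y\<in>X. K x y * ?e y)) = (\<Sum>y\<in>X. K z y * g y)"
    unfolding row by (simp add: sym[of _ z] mult.commute)
  also have "(\<Sum>x\<in>X. ?e x * (\<Sum>y\<in>X. K x y * g y)) = (\<Sum>y\<in>X. K z y * g y)"
    using X z by (simp add: of_bool_def if_distrib if_distribR cong: if_cong)
  also have "(\<Sum>x\<in>X. ?e x * (\<Sum>y\<in>X. K x y * ?e y)) = K z z"
    unfolding row using X z by (simp add: of_bool_def if_distrib if_distribR cong: if_cong)
  finally show "0 \<le> 2 * t * (\<Sum>y\<in>X. K z y * g y) + t\<^sup>2 * K z z"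
    using psd[of "\<lambda>x. g x + t * ?e x"] g by simp
qed

text \<open>
The topology is that of pointwise convergence. Since the values off \<open>X\<close> are fixed to be zero, the
sphere is a closed subset of a product of compact intervals and points.
\<close>

lemma compact_unit_sphere_functions:
  assumes X: "finite X"
  shows "compact {f :: 'b \<Rightarrow> real. (\<forall>x. x \<notin> X \<longrightarrow> f x = 0) \<and> (\<Sum>x\<in>X. (f x)\<^sup>2) = 1}" (is "compact ?S")
proof -
  let ?B = "PiE UNIV (\<lambda>x. if x \<in> X then {-1..1} else {0::real})"
  have "compactin (product_topology (\<lambda>_. euclidean) UNIV) ?B"
    by (subst compactin_PiE) auto
  then have B: "compact ?B"
    by (simp add: euclidean_product_topology)
  have "closed {f :: 'b \<Rightarrow> real. (\<Sum>x\<in>X. (f x)\<^sup>2) = 1}"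
    by (intro closed_Collect_eq continuous_intros continuous_on_product_coordinates)
  with B have "compact (?B \<inter> {f. (\<Sum>x\<in>X. (f x)\<^sup>2) = 1})"
    by (rule compact_Int_closed)
  moreover have "\<bar>f x\<bar> \<le> 1" if "(\<Sum>x\<in>X. (f x)\<^sup>2) = 1" "x \<in> X" for f :: "'b \<Rightarrow> real" and x
  proof -
    have "(f x)\<^sup>2 \<le> 1"
      using member_le_sum[of x X "\<lambda>x. (f x)\<^sup>2"] X that by simp
    then show ?thesis by (simp add: abs_square_le_1)
  qed
  then have "?S = ?B \<inter> {f. (\<Sum>x\<in>X. (f x)\<^sup>2) = 1}"
    by (fastforce simp: PiE_iff abs_le_iff split: if_splits)
  ultimately show ?thesis by simp
qed

text \<open>
The eigenvalue is the minimum \<open>\<theta>\<close> of the form on the unit sphere. Subtracting \<open>\<theta>\<close> on the diagonal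
makes the form positive semidefinite and the minimiser isotropic, hence a null vector.
\<close>

lemma negative_form_has_negative_eigenvector:
  assumes X: "finite X" and sym: "\<And>x y. K x y = K y x" and neg: "quad K X f < 0"
  obtains \<theta> g where "\<theta> < 0" "eigenvector K X \<theta> g"
proof -
  let ?N = "\<lambda>h. \<Sum>x\<in>X. (h x)\<^sup>2 :: real"
  let ?S = "{h. (\<forall>x. x \<notin> X \<longrightarrow> h x = 0) \<and> ?N h = 1}"
  define normalise where "normalise h = (\<lambda>x. if x \<in> X then h x / sqrt (?N h) else 0)" for h
  have N_pos: "?N h > 0" if "quad K X h \<noteq> 0" for h
  proof -
    have "\<exists>x\<in>X. h x \<noteq> 0"
      using that unfolding quad_def by (metis (mono_tags, lifting) mult_zero_right sum.neutral)
    then show ?thesis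
      using X by (metis (no_types, lifting) sum_pos2 zero_le_power2 zero_less_power2)
  qed
  have in_S: "normalise h \<in> ?S" if "?N h > 0" for h
  proof -
    have "?N (normalise h) = (\<Sum>x\<in>X. (h x)\<^sup>2 / ?N h)"
      using that by (intro sum.cong) (auto simp: normalise_def power_divide)
    also have "\<dots> = 1"
      using that by (simp flip: sum_divide_distrib)
    finally show ?thesis by (simp add: normalise_def)
  qed
  have quad_normalise: "quad K X (normalise h) = quad K X h / ?N h" if "?N h > 0" for h
  proof -
    have sq: "sqrt (?N h) * sqrt (?N h) = ?N h" using that by simp
    have "quad K X (normalise h) = (\<Sum>x\<in>X. \<Sum>y\<in>X. K x y * h x * h y / (sqrt (?N h) * sqrt (?N h)))"
      unfolding quad_def by (intro sum.cong) (auto simp: normalise_def)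
    then show ?thesis
      unfolding sq quad_def by (simp add: sum_divide_distrib)
  qed
  have cont: "continuous_on ?S (quad K X)"
    unfolding quad_def
    by (intro continuous_intros continuous_on_product_then_coordinatewise continuous_on_id)
  have f: "?N f > 0" using N_pos neg by force
  then have "?S \<noteq> {}" using in_S by blast
  then obtain g where g: "g \<in> ?S" and min: "\<And>h. h \<in> ?S \<Longrightarrow> quad K X g \<le> quad K X h"
    using continuous_attains_inf[OF compact_unit_sphere_functions[OF X] _ cont] by blast
  define \<theta> where "\<theta> = quad K X g"
  have lower: "\<theta> * ?N h \<le> quad K X h" for h
  proof (cases "?N h > 0")
    case True
    then have "\<theta> \<le> quad K X h / ?N h"
      using min[OF in_S[OF True]] quad_normalise[OF True] by (simp add: \<theta>_def)
    with True show ?thesis by (simp add: field_simps)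
  next
    case False
    then have "?N h = 0" using sum_nonneg[of X "\<lambda>x. (h x)\<^sup>2"] by force
    with False N_pos[of h] show ?thesis by fastforce
  qed
  have "\<theta> < 0"
    using lower[of f] neg f by (smt (verit) mult_nonneg_nonneg)
  moreover have "\<exists>x\<in>X. g x \<noteq> 0"
  proof (rule ccontr)
    assume "\<not> (\<exists>x\<in>X. g x \<noteq> 0)"
    then have "?N g = 0" by simp
    with g show False by simp
  qed
  moreover have "(\<Sum>y\<in>X. K x y * g y) = \<theta> * g x" if x: "x \<in> X" for x
  proof -
    let ?L = "\<lambda>x y. K x y - \<theta> * of_bool (x = y)"
    have quad_L: "quad ?L X h = quad K X h - \<theta> * ?N h" for h
    proof -
      have "(\<Sum>y\<in>X. ?L x y * h x * h y) = (\<Sum>y\<in>X. K x y * h x * h y) - \<theta> * (h x)\<^sup>2"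
        if "x \<in> X" for x
      proof -
        have "(\<Sum>y\<in>X. ?L x y * h x * h y) = (\<Sum>y\<in>X. K x y * h x * h y) - \<theta> * h x * (\<Sum>y\<in>X. of_bool (x = y) * h y)"
          by (simp add: left_diff_distrib sum_subtractf sum_distrib_left algebra_simps)
        then show ?thesis
          using sum_of_bool_eq_mult[OF X that, of h] by (simp add: power2_eq_square)
      qed
      then show ?thesis
        by (simp add: quad_def sum_subtractf sum_distrib_left)
    qed
    have "(\<Sum>y\<in>X. ?L x y * g y) = 0"
    proof (rule isotropic_imp_null_vector[OF X _ _ _ x])
      show "?L x y = ?L y x" for x y using sym[of x y] by auto
      show "0 \<le> quad ?L X h" for h using lower[of h] quad_L by simp
      show "quad ?L X g = 0" using g quad_L by (simp add: \<theta>_def)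
    qed
    then have "(\<Sum>y\<in>X. K x y * g y) - \<theta> * (\<Sum>y\<in>X. of_bool (x = y) * g y) = 0"
      by (simp add: left_diff_distrib sum_subtractf sum_distrib_left mult.assoc)
    then show ?thesis
      using sum_of_bool_eq_mult[OF X x, of g] by simp
  qed
  ultimately show ?thesis
    by (intro that) (auto simp: eigenvector_def)
qed

section \<open>Kernels on k-sets and the swap difference\<close>

definition ksets :: "nat \<Rightarrow> 'a set \<Rightarrow> 'a set set" where
  "ksets k V = {F. F \<subseteq> V \<and> card F = k}"

text \<open>
The family is closed under taking swap differences, which is why the four terms are carried
together: the differences turn the term \<open>|F \<inter> G|\<close> into a constant and a constant into zero.
\<close>

definition scheme_kernel :: "real \<Rightarrow> real \<Rightarrow> real \<Rightarrow> real \<Rightarrow> 'a set \<Rightarrow> 'a set \<Rightarrow> real" where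
  "scheme_kernel s m b c F G = s * of_bool (F \<inter> G = {}) + m * of_bool (F = G) + b * real (card (F \<inter> G)) + c"

definition swap_diff :: "'a \<Rightarrow> 'a \<Rightarrow> ('a set \<Rightarrow> real) \<Rightarrow> 'a set \<Rightarrow> real" where
  "swap_diff x y f S = f (insert x S) - f (insert y S)"

lemma kernel_sym: "scheme_kernel s m b c F G = scheme_kernel s m b c G F"
  by (simp add: scheme_kernel_def Int_commute eq_commute)

lemma finite_ksets: "finite V \<Longrightarrow> finite (ksets k V)"
  by (simp add: ksets_def)

lemma card_ksets: "finite V \<Longrightarrow> card (ksets k V) = card V choose k"
  by (simp add: ksets_def n_subsets)

lemma insert_in_ksets:
  assumes "finite V" "z \<in> V" "z \<in> W" "T \<in> ksets k (V - W)"
  shows "insert z T \<in> ksets (Suc k) V"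
proof -
  have "finite T" "z \<notin> T" using assms by (auto simp: ksets_def dest: finite_subset)
  then show ?thesis using assms by (auto simp: ksets_def)
qed

lemma card_ksets_disjoint:
  assumes "finite V" "F \<in> ksets k V"
  shows "card {G \<in> ksets k V. F \<inter> G = {}} = (card V - k) choose k"
proof -
  have "{G \<in> ksets k V. F \<inter> G = {}} = ksets k (V - F)"
    by (auto simp: ksets_def)
  moreover have "card (V - F) = card V - k"
    using assms finite_subset[of F V] by (auto simp: ksets_def card_Diff_subset)
  ultimately show ?thesis
    using assms by (simp add: card_ksets)
qed

lemma card_ksets_containing:
  assumes V: "finite V" and v: "v \<in> V"
  shows "card {G \<in> ksets (Suc k) V. v \<in> G} = (card V - 1) choose k"
proof -
  have "bij_betw (insert v) (ksets k (V - {v})) {G \<in> ksets (Suc k) V. v \<in> G}"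
  proof (rule bij_betw_byWitness[where f' = "\<lambda>G. G - {v}"])
    show "insert v ` ksets k (V - {v}) \<subseteq> {G \<in> ksets (Suc k) V. v \<in> G}"
      using V v by (auto simp: ksets_def subset_Diff_insert card_insert_disjoint finite_subset)
  qed (use V v in \<open>auto simp: ksets_def\<close>)
  then show ?thesis
    using V v by (simp add: card_ksets flip: bij_betw_same_card)
qed

lemma sum_card_Int:
  assumes "finite \<A>" "finite F"
  shows "(\<Sum>G\<in>\<A>. card (F \<inter> G)) = (\<Sum>v\<in>F. card {G \<in> \<A>. v \<in> G})"
proof -
  have "(\<Sum>G\<in>\<A>. card (F \<inter> G)) = (\<Sum>G\<in>\<A>. \<Sum>v\<in>F. of_bool (v \<in> G))"
    using assms by (simp add: of_bool_def flip: sum.inter_filter) (simp add: Int_def)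
  also have "\<dots> = (\<Sum>v\<in>F. \<Sum>G\<in>\<A>. of_bool (v \<in> G))"
    by (rule sum.swap)
  also have "\<dots> = (\<Sum>v\<in>F. card {G \<in> \<A>. v \<in> G})"
    using assms by (simp add: of_bool_def flip: sum.inter_filter)
  finally show ?thesis .
qed

lemma kernel_row_sum:
  assumes V: "finite V" and F: "F \<in> ksets k V" 
  shows "(\<Sum>G\<in>ksets k V. scheme_kernel s m b c F G)
    = s * ((card V - k) choose k) + m + b * (k * ((card V - 1) choose (k - 1))) + c * (card V choose k)"
proof -
  have fin: "finite (ksets k V)" "finite F"
    using V F finite_ksets by (auto simp: ksets_def finite_subset)
  have "(\<Sum>G\<in>ksets k V. of_bool (F \<inter> G = {})) = real ((card V - k) choose k)"
    using fin card_ksets_disjoint[OF V F] by (simp add: of_bool_def flip: sum.inter_filter)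
  moreover have "(\<Sum>G\<in>ksets k V. of_bool (F = G)) = (1 :: real)"
    using fin F by (simp add: of_bool_def)
  moreover have "(\<Sum>G\<in>ksets k V. card (F \<inter> G)) = k * ((card V - 1) choose (k - 1))"
  proof (cases k)
    case (Suc j)
    have "(\<Sum>v\<in>F. card {G \<in> ksets k V. v \<in> G}) = (\<Sum>v\<in>F. (card V - 1) choose j)"
      using F card_ksets_containing[OF V] unfolding Suc by (intro sum.cong) (auto simp: ksets_def)
    also have "\<dots> = k * ((card V - 1) choose (k - 1))"
      using F Suc by (simp add: ksets_def)
    finally show ?thesis
      by (simp only: sum_card_Int[OF fin])
  qed (use V in \<open>auto simp: ksets_def finite_subset\<close>)
  then have "(\<Sum>G\<in>ksets k V. real (card (F \<inter> G))) = k * ((card V - 1) choose (k - 1))"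
    by (metis of_nat_sum)
  ultimately show ?thesis
    using card_ksets[OF V]
    by (simp add: scheme_kernel_def sum.distrib flip: sum_distrib_left)
qed

text \<open>
Vanishing of the differences means that exchanging one element does not change the value, and any
\<open>k\<close>-set becomes any other by exchanging the elements of \<open>F - G\<close> one at a time.
\<close>

lemma swap_diff_zero_imp_constant:
  assumes V: "finite V"
    and zero: "\<And>x y S. x \<in> V \<Longrightarrow> y \<in> V \<Longrightarrow> x \<noteq> y \<Longrightarrow> S \<in> ksets (k - 1) (V - {x, y}) \<Longrightarrow> swap_diff x y f S = 0"
    and F: "F \<in> ksets k V" and G: "G \<in> ksets k V"
  shows "f F = f G"
  using F
proof (induction "card (F - G)" arbitrary: F)
  case 0
  have "finite F" "finite G" "card F = card G"
    using 0 G V by (auto simp: ksets_def finite_subset)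
  with 0 show ?case by (metis Diff_eq_empty_iff card_0_eq card_subset_eq finite_Diff)
next
  case (Suc d)
  have fin: "finite F" "finite G" and card: "card F = k" "card G = k" and sub: "F \<subseteq> V" "G \<subseteq> V"
    using Suc.prems G V by (auto simp: ksets_def finite_subset)
  obtain x where x: "x \<in> F" "x \<notin> G" using Suc.hyps by (metis Diff_iff card.empty ex_in_conv nat.distinct(1))
  have "card (G - F) = card (F - G)"
    using fin card by (metis card_le_sym_Diff dual_order.antisym order_refl)
  then obtain y where y: "y \<in> G" "y \<notin> F" using Suc.hyps by (metis Diff_iff card.empty ex_in_conv nat.distinct(1))
  define S where "S = F - {x}"
  have S: "S \<in> ksets (k - 1) (V - {x, y})" and F: "F = insert x S"
    using fin card sub x y by (auto simp: S_def ksets_def)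
  have "f F = f (insert y S)"
    using zero[OF _ _ _ S] x y sub unfolding F swap_diff_def by fastforce
  moreover have "f (insert y S) = f G"
  proof (rule Suc.hyps(1))
    have "insert y S - G = (F - G) - {x}" using x y by (auto simp: S_def)
    then show "d = card (insert y S - G)" using Suc.hyps(2) x fin by simp
    have "card (insert y S) = k"
      using card_Suc_Diff1[of F x] x y fin card by (simp add: S_def)
    then show "insert y S \<in> ksets k V" using y sub by (auto simp: ksets_def S_def)
  qed
  ultimately show ?case by simp
qed

text \<open>
Replacing \<open>x\<close> by \<open>y\<close> in the first set destroys equality, removes one common element, and
makes the two sets disjoint if \<open>S\<close> and \<open>T\<close> are. The sign of the disjointness term
therefore flips, and the intersection term becomes the constant \<open>b\<close>.
\<close>

lemma kernel_swap_diff: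
  assumes "x \<notin> S" "y \<notin> S" "x \<notin> T" "y \<notin> T" "x \<noteq> y" "finite S"
  shows "scheme_kernel s m b c (insert x S) (insert x T) - scheme_kernel s m b c (insert y S) (insert x T) = scheme_kernel (- s) m 0 b S T"
proof -
  have "(insert x S = insert x T) = (S = T)" using assms by (metis insert_ident)
  moreover have "insert y S \<noteq> insert x T" using assms by auto
  moreover have "insert y S \<inter> insert x T = S \<inter> T" "insert x S \<inter> insert x T = insert x (S \<inter> T)"
    using assms by auto
  ultimately show ?thesis
    using assms by (simp add: scheme_kernel_def algebra_simps)
qed

text \<open>
Only those \<open>G\<close> contribute to the difference of the rows \<open>S \<union> {x}\<close> and \<open>S \<union> {y}\<close> that contain
exactly one of \<open>x\<close> and \<open>y\<close>; the transposition of \<open>x\<close> and \<open>y\<close> fixes all others.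
\<close>

lemma sum_kernel_swap_diff:
  assumes V: "finite V" and x: "x \<in> V" and y: "y \<in> V" and xy: "x \<noteq> y"
    and S: "S \<in> ksets k (V - {x, y})"
  shows "(\<Sum>T\<in>ksets k (V - {x, y}). scheme_kernel (- s) m 0 b S T * swap_diff x y f T)
    = swap_diff x y (\<lambda>F. \<Sum>G\<in>ksets (Suc k) V. scheme_kernel s m b c F G * f G) S"
proof -
  let ?D = "\<lambda>G. (scheme_kernel s m b c (insert x S) G - scheme_kernel s m b c (insert y S) G) * f G"
  let ?T = "ksets k (V - {x, y})"
  have finT: "finite ?T" using V by (simp add: finite_ksets)
  have S': "x \<notin> S" "y \<notin> S" "finite S"
    using S V by (auto simp: ksets_def dest: finite_subset)
  have T': "x \<notin> T" "y \<notin> T" "finite T" if "T \<in> ?T" for T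
    using that V by (auto simp: ksets_def dest: finite_subset)
  have inj: "inj_on (insert z) ?T" if "z \<in> {x, y}" for z
    using that by (intro inj_onI) (metis T'(1,2) insert_ident insertE singletonD)
  have disj: "insert x ` ?T \<inter> insert y ` ?T = {}"
    using xy T' by (auto simp: set_eq_iff)
  have sub: "insert x ` ?T \<union> insert y ` ?T \<subseteq> ksets (Suc k) V"
    using insert_in_ksets[OF V x, of "{x, y}"] insert_in_ksets[OF V y, of "{x, y}"] by auto
  have zero: "?D G = 0" if G: "G \<in> ksets (Suc k) V - (insert x ` ?T \<union> insert y ` ?T)" for G
  proof -
    have *: "G \<in> insert z ` ?T" if "z \<in> G" "{x, y} = {z, w}" "w \<notin> G" for z w
    proof
      show "G = insert z (G - {z})" using that by auto
      show "G - {z} \<in> ?T" using that G V by (auto simp: ksets_def dest: finite_subset)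
    qed
    \<comment> \<open>A set containing exactly one of \<open>x\<close>, \<open>y\<close> would lie in one of the two images.\<close>
    have iff: "x \<in> G \<longleftrightarrow> y \<in> G" using * G by blast
    have "card (insert x S \<inter> G) = card (insert y S \<inter> G)"
      using iff S' xy by (simp add: Int_insert_left)
    moreover have "insert x S \<inter> G = {} \<longleftrightarrow> insert y S \<inter> G = {}" using iff by auto
    moreover have "insert x S \<noteq> G" "insert y S \<noteq> G" using iff S' xy by auto
    ultimately show ?thesis by (simp add: scheme_kernel_def)
  qed
  have "swap_diff x y (\<lambda>F. \<Sum>G\<in>ksets (Suc k) V. scheme_kernel s m b c F G * f G) S = (\<Sum>G\<in>ksets (Suc k) V. ?D G)"
    by (simp add: swap_diff_def left_diff_distrib sum_subtractf)
  also have "\<dots> = (\<Sum>G\<in>insert x ` ?T \<union> insert y ` ?T. ?D G)"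
    using zero sub V by (intro sum.mono_neutral_right) (auto simp: finite_ksets)
  also have "\<dots> = (\<Sum>T\<in>?T. ?D (insert x T)) + (\<Sum>T\<in>?T. ?D (insert y T))"
    using disj finT inj by (simp add: sum.union_disjoint sum.reindex)
  also have "(\<Sum>T\<in>?T. ?D (insert x T)) = (\<Sum>T\<in>?T. scheme_kernel (- s) m 0 b S T * f (insert x T))"
    using S' T' xy by (intro sum.cong) (auto simp: kernel_swap_diff)
  also have "(\<Sum>T\<in>?T. ?D (insert y T)) = (\<Sum>T\<in>?T. - scheme_kernel (- s) m 0 b S T * f (insert y T))"
  proof (intro sum.cong refl)
    fix T assume "T \<in> ?T"
    then have "scheme_kernel s m b c (insert y S) (insert y T) - scheme_kernel s m b c (insert x S) (insert y T) = scheme_kernel (- s) m 0 b S T"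
      using S' T' xy by (intro kernel_swap_diff) auto
    then show "?D (insert y T) = - scheme_kernel (- s) m 0 b S T * f (insert y T)"
      by (smt (verit) mult_minus_left)
  qed
  finally show ?thesis
    by (simp add: swap_diff_def right_diff_distrib sum_subtractf sum_negf)
qed

text \<open>
Summation against the kernel commutes with the swap difference up to the change of parameters, so
the eigenvalue equation is inherited; the only thing that can go wrong is that the difference vanishes.
\<close>

lemma eigenvector_swap_diff:
  assumes V: "finite V" and x: "x \<in> V" and y: "y \<in> V" and xy: "x \<noteq> y"
    and f: "eigenvector (scheme_kernel s m b c) (ksets (Suc k) V) \<theta> f"
    and nz: "S \<in> ksets k (V - {x, y})" "swap_diff x y f S \<noteq> 0"
  shows "eigenvector (scheme_kernel (- s) m 0 b) (ksets k (V - {x, y})) \<theta> (swap_diff x y f)"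
  unfolding eigenvector_def
proof (intro conjI ballI)
  fix T assume T: "T \<in> ksets k (V - {x, y})"
  then have "insert x T \<in> ksets (Suc k) V" "insert y T \<in> ksets (Suc k) V"
    using insert_in_ksets[OF V x, of "{x, y}"] insert_in_ksets[OF V y, of "{x, y}"] by auto
  with f show "(\<Sum>U\<in>ksets k (V - {x, y}). scheme_kernel (- s) m 0 b T U * swap_diff x y f U) = \<theta> * swap_diff x y f T"
    unfolding sum_kernel_swap_diff[OF V x y xy T, of s m b f c]
    by (simp add: eigenvector_def swap_diff_def right_diff_distrib)
qed (use nz in blast)

text \<open>
The induction principle for eigenvalues: descend to smaller sets as long as some swap difference is
nonzero, and otherwise read the eigenvalue off a row sum.
\<close>

lemma eigenvalue_cases:
  assumes V: "finite V" and f: "eigenvector (scheme_kernel s m b c) (ksets k V) \<theta> f"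
  obtains (const) "\<theta> = s * ((card V - k) choose k) + m + b * (k * ((card V - 1) choose (k - 1))) + c * (card V choose k)"
  | (difference) x y where "0 < k" "x \<in> V" "y \<in> V" "x \<noteq> y"
      "eigenvector (scheme_kernel (- s) m 0 b) (ksets (k - 1) (V - {x, y})) \<theta> (swap_diff x y f)"
proof (cases "\<exists>F\<in>ksets k V. \<exists>G\<in>ksets k V. f F \<noteq> f G")
  case False
  obtain F where F: "F \<in> ksets k V" "f F \<noteq> 0" using f by (auto simp: eigenvector_def)
  have "\<theta> * f F = (\<Sum>G\<in>ksets k V. scheme_kernel s m b c F G * f G)"
    using f F by (simp add: eigenvector_def)
  also have "\<dots> = (\<Sum>G\<in>ksets k V. scheme_kernel s m b c F G * f F)"
  proof (intro sum.cong refl)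
    fix G assume "G \<in> ksets k V"
    then have "f G = f F" using False F by blast
    then show "scheme_kernel s m b c F G * f G = scheme_kernel s m b c F G * f F" by simp
  qed
  also have "\<dots> = (\<Sum>G\<in>ksets k V. scheme_kernel s m b c F G) * f F"
    by (rule sum_distrib_right[symmetric])
  finally show ?thesis using F(2) const unfolding kernel_row_sum[OF V F(1)] by simp
next
  case True
  have k: "k \<noteq> 0"
  proof
    assume "k = 0"
    then have "ksets k V = {{}}" using V by (auto simp: ksets_def dest: finite_subset)
    with True show False by simp
  qed
  from True obtain x y S where xy: "x \<in> V" "y \<in> V" "x \<noteq> y" "S \<in> ksets (k - 1) (V - {x, y})" "swap_diff x y f S \<noteq> 0"
    using swap_diff_zero_imp_constant[OF V, of k f] by blast
  have "eigenvector (scheme_kernel s m b c) (ksets (Suc (k - 1)) V) \<theta> f"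
    using f k by simp
  with k xy show ?thesis
    by (intro difference[of x y] eigenvector_swap_diff[OF V]) auto
qed

text \<open>
The maximum norm bound on eigenvalues: evaluate the eigenvalue equation at a set where the absolute
value of the eigenvector is largest.
\<close>

lemma eigenvalue_ge_row_sum:
  assumes V: "finite V" and s: "s \<ge> 0" and f: "eigenvector (scheme_kernel (- s) m 0 0) (ksets k V) \<theta> f"
  shows "\<theta> \<ge> m - s * ((card V - k) choose k)"
proof -
  let ?X = "ksets k V"
  have fin: "finite ?X" and ne: "?X \<noteq> {}" using V f by (auto simp: finite_ksets eigenvector_def)
  have "Max ((\<lambda>G. \<bar>f G\<bar>) ` ?X) \<in> (\<lambda>G. \<bar>f G\<bar>) ` ?X"
    using fin ne by (intro Max_in) auto
  then obtain F where F: "F \<in> ?X" and "\<bar>f F\<bar> = Max ((\<lambda>G. \<bar>f G\<bar>) ` ?X)"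
    by force
  then have max: "\<bar>f G\<bar> \<le> \<bar>f F\<bar>" if "G \<in> ?X" for G
    using fin that by simp
  then have pos: "\<bar>f F\<bar> > 0"
    using f by (fastforce simp: eigenvector_def)
  have "(\<Sum>G\<in>?X. scheme_kernel (- s) m 0 0 F G * f G) = m * f F - s * (\<Sum>G\<in>?X. of_bool (F \<inter> G = {}) * f G)"
  proof -
    have "(\<Sum>G\<in>?X. scheme_kernel (- s) m 0 0 F G * f G)
      = (\<Sum>G\<in>?X. m * (of_bool (F = G) * f G) - s * (of_bool (F \<inter> G = {}) * f G))"
      by (intro sum.cong refl) (simp add: scheme_kernel_def left_diff_distrib del: of_bool_eq_iff)
    also have "\<dots> = m * (\<Sum>G\<in>?X. of_bool (F = G) * f G) - s * (\<Sum>G\<in>?X. of_bool (F \<inter> G = {}) * f G)"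
      by (simp only: sum_subtractf sum_distrib_left)
    finally show ?thesis
      by (simp only: sum_of_bool_eq_mult[OF fin F])
  qed
  then have "(m - \<theta>) * f F = s * (\<Sum>G\<in>?X. of_bool (F \<inter> G = {}) * f G)"
    using f F by (simp add: eigenvector_def algebra_simps)
  then have "\<bar>m - \<theta>\<bar> * \<bar>f F\<bar> = s * \<bar>\<Sum>G\<in>?X. of_bool (F \<inter> G = {}) * f G\<bar>"
    using s by (metis abs_mult abs_of_nonneg)
  also have "\<dots> \<le> s * (\<Sum>G\<in>?X. of_bool (F \<inter> G = {}) * \<bar>f F\<bar>)"
    using s max by (intro mult_left_mono order_trans[OF sum_abs] sum_mono) (auto simp: abs_mult)
  also have "(\<Sum>G\<in>?X. of_bool (F \<inter> G = {}) * \<bar>f F\<bar>) = card {G \<in> ?X. F \<inter> G = {}} * \<bar>f F\<bar>"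
    using fin by (simp add: of_bool_def flip: sum_distrib_right sum.inter_filter)
  also have "\<dots> = ((card V - k) choose k) * \<bar>f F\<bar>"
    using card_ksets_disjoint[OF V F] by simp
  finally have "\<bar>m - \<theta>\<bar> \<le> s * ((card V - k) choose k)"
    using pos by (simp flip: mult.assoc)
  then show ?thesis by linarith
qed

section \<open>Positivity of the scheme_kernel\<close>

text \<open>
The binomials on the left and on the right are in the ratio \<open>(k-1) (k-2)\<close> to
\<open>(n-k-1) (n-k-2)\<close>. After cancellation the claim is \<open>(k-1)\<^sup>2 \<le> (n-k-1) (n-k-2)\<close>, which fails
for \<open>n = 2 k\<close>.
\<close>

lemma Kneser_binomial_ratio:
  assumes k: "3 \<le> k" and n: "2 * k + 1 \<le> n"
  shows "(k - 1) * ((n - k - 3) choose (k - 3)) \<le> (k - 2) * ((n - k - 1) choose (k - 1))"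
proof -
  define p q where "p = (n - k - 3) choose (k - 3)" and "q = (n - k - 1) choose (k - 1)"
  have "(k - 1) * q = (n - k - 1) * ((n - k - 2) choose (k - 2))"
    using times_binomial_minus1_eq[of "k - 1" "n - k - 1"] k by (simp add: q_def numeral_2_eq_2)
  moreover have "(k - 2) * ((n - k - 2) choose (k - 2)) = (n - k - 2) * p"
    using times_binomial_minus1_eq[of "k - 2" "n - k - 2"] k by (simp add: p_def numeral_3_eq_3 numeral_2_eq_2)
  ultimately have "(k - 1) * ((k - 2) * q) = (n - k - 1) * ((n - k - 2) * p)"
    by (metis mult.left_commute)
  moreover have "(k - 1) * ((k - 1) * p) \<le> (n - k - 1) * ((n - k - 2) * p)"
    using n by (intro mult_mono) auto
  ultimately have "(k - 1) * ((k - 1) * p) \<le> (k - 1) * ((k - 2) * q)"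
    by simp
  then show ?thesis
    using k by (simp add: p_def q_def)
qed

text \<open>
The row sum of the kernel \<open>K\<close>, with \<open>q\<close>, \<open>X\<close>, \<open>Y\<close>, \<open>M\<close>, \<open>a\<close> standing for the binomials
\<open>(n-k-1 choose k-1)\<close>, \<open>(n-k choose k)\<close>, \<open>(n choose k)\<close>, \<open>(n-1 choose k-1)\<close>, \<open>(n-2 choose k-1)\<close>.
\<close>

lemma trivial_eigenvalue_zero:
  fixes k n a q M X Y :: real
  assumes pos: "k > 0" "n > 1" "q > 0"
    and X: "k * X = (n - k) * q" and Y: "k * Y = n * M" and a: "(n - 1) * a = (n - k) * M"
  shows "(k - 1) * a / q * X + (k - 2) * a + k * M - n * (k - 1) / (n - 1) * Y = 0"
proof -
  have X': "X = (n - k) * q / k" and Y': "Y = n * M / k" and a': "a = (n - k) * M / (n - 1)"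
    using pos X Y a by (simp_all add: field_simps)
  have level: "(k - 1) * a / q * X = (k - 1) * a * (n - k) / k"
    unfolding X' using pos by simp
  have "(k - 1) * a / q * X + (k - 2) * a + k * M - n * (k - 1) / (n - 1) * Y
    = M * ((k - 1) * (n - k)\<^sup>2 + k * (k - 2) * (n - k) + k\<^sup>2 * (n - 1) - n\<^sup>2 * (k - 1)) / (k * (n - 1))"
    unfolding level unfolding Y' a' using pos by (simp add: divide_simps power2_eq_square) (simp add: algebra_simps)
  also have "(k - 1) * (n - k)\<^sup>2 + k * (k - 2) * (n - k) + k\<^sup>2 * (n - 1) - n\<^sup>2 * (k - 1) = 0"
    by (simp add: algebra_simps power2_eq_square)
  finally show ?thesis by simp
qed

text \<open>
Differences are taken until the eigenvector becomes constant, but at most three times. If it is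
constant at the start or after one difference, the eigenvalue is zero; after two differences it is
a sum of nonnegative terms. Otherwise a nonzero eigenvector of the kernel
\<open>- s * [F \<inter> G = {}] + \<mu> * [F = G]\<close> on the \<open>(k-3)\<close>-subsets of an \<open>(n-6)\<close>-set remains, and \<open>\<mu>\<close>
dominates the row sum of the disjointness term.
\<close>

lemma kernel_eigenvalue_nonneg:
  fixes V :: "'a set" and k n :: nat
  defines "a \<equiv> real ((n - 2) choose (k - 1))"
  defines "s \<equiv> (real k - 1) * a / real ((n - k - 1) choose (k - 1))"
  assumes V: "finite V" "card V = n" and k: "2 \<le> k" and n: "2 * k + 1 \<le> n"
    and f: "eigenvector (scheme_kernel s ((real k - 2) * a) 1 (- real n * (real k - 1) / (real n - 1))) (ksets k V) \<theta> f"
  shows "0 \<le> \<theta>"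
  using V(1) f
proof (cases rule: eigenvalue_cases)
  case const
  define q where "q = (n - k - 1) choose (k - 1)"
  have "k * ((n - k) choose k) = (n - k) * q"
    using times_binomial_minus1_eq[of k "n - k"] k by (simp add: q_def)
  then have "real k * ((n - k) choose k) = real (n - k) * q"
    by (metis of_nat_mult)
  then have X: "real k * ((n - k) choose k) = (real n - real k) * q"
    using n by (simp add: of_nat_diff)
  have "k * (n choose k) = n * ((n - 1) choose (k - 1))"
    using times_binomial_minus1_eq[of k n] k by simp
  then have Y: "real k * (n choose k) = real n * ((n - 1) choose (k - 1))"
    by (metis of_nat_mult)
  have "(n - 1) * ((n - 2) choose (k - 1)) = (n - k) * ((n - 1) choose (k - 1))"
    using binomial_absorb_comp[of "n - 1" "k - 1"] k n by (simp add: numeral_2_eq_2)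
  then have "real (n - 1) * a = real (n - k) * ((n - 1) choose (k - 1))"
    unfolding a_def by (metis of_nat_mult)
  then have a: "(real n - 1) * a = (real n - real k) * ((n - 1) choose (k - 1))"
    using n by (simp add: of_nat_diff)
  have "q > 0" using n k by (simp add: q_def)
  then have "(real k - 1) * a / q * ((n - k) choose k) + (real k - 2) * a + real k * ((n - 1) choose (k - 1))
      - real n * (real k - 1) / (real n - 1) * (n choose k) = 0"
    using k n by (intro trivial_eigenvalue_zero X Y a) auto
  then show ?thesis
    using const V by (simp add: s_def q_def)
next
  case (difference x y)
  let ?V1 = "V - {x, y}"
  have card1: "card ?V1 = n - 2" and V1: "finite ?V1"
    using difference V by (auto simp: card_Diff_subset)
  from V1 difference(5) show ?thesis
  proof (cases rule: eigenvalue_cases)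
    case const
    have "n - 2 - (k - 1) = n - k - 1" using k by simp
    moreover have "s * ((n - k - 1) choose (k - 1)) = (real k - 1) * a"
      using n k by (simp add: s_def)
    ultimately show ?thesis
      using const card1 by (simp add: a_def algebra_simps)
  next
    case (difference z w)
    let ?V2 = "?V1 - {z, w}"
    have card2: "card ?V2 = n - 4" and V2: "finite ?V2"
      using difference V1 card1 by (auto simp: card_Diff_subset)
    have a: "a \<ge> 0" and s: "s \<ge> 0" using k by (auto simp: a_def s_def)
    have f2: "eigenvector (scheme_kernel s ((real k - 2) * a) 0 0) (ksets (k - 2) ?V2) \<theta> (swap_diff z w (swap_diff x y f))"
      using difference(5) by (simp add: numeral_2_eq_2)
    from V2 f2 show ?thesis
    proof (cases rule: eigenvalue_cases)
      case const
      then show ?thesis using a s k by simp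
    next
      case (difference u v)
      let ?V3 = "?V2 - {u, v}"
      define p q where "p = (n - k - 3) choose (k - 3)" and "q = (n - k - 1) choose (k - 1)"
      have card3: "card ?V3 = n - 6" and V3: "finite ?V3"
        using difference V2 card2 by (auto simp: card_Diff_subset)
      have "3 \<le> k" using difference(1) by simp
      then have "n - 6 - (k - 2 - 1) = n - k - 3" "k - 2 - 1 = k - 3" using n by auto
      then have "(real k - 2) * a - s * p \<le> \<theta>"
        using eigenvalue_ge_row_sum[OF V3 s difference(5)] card3 by (simp add: p_def)
      moreover have "s * p \<le> (real k - 2) * a"
      proof -
        have "real (k - 1) * p \<le> real (k - 2) * q"
          using Kneser_binomial_ratio[OF \<open>3 \<le> k\<close> n] unfolding p_def q_def
          by (simp flip: of_nat_mult)
        then have "(real k - 1) * p \<le> (real k - 2) * q"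
          using \<open>3 \<le> k\<close> by (simp add: of_nat_diff)
        moreover have "q > 0" using n k by (simp add: q_def)
        ultimately have "(real k - 1) * p / q \<le> real k - 2"
          by (simp add: divide_le_eq)
        then have "a * ((real k - 1) * p / q) \<le> a * (real k - 2)"
          using a by (rule mult_left_mono)
        then show ?thesis by (simp add: s_def q_def mult_ac)
      qed
      ultimately show ?thesis by linarith
    qed
  qed
qed

section \<open>Degrees in intersecting families\<close>

lemma sum_edges_sum_vertices:
  fixes g :: "'a \<Rightarrow> real"
  assumes "finite V" "finite E" "\<And>e. e \<in> E \<Longrightarrow> e \<subseteq> V"
  shows "(\<Sum>e\<in>E. \<Sum>v\<in>e. g v) = (\<Sum>v\<in>V. vertex_degree E v * g v)"
proof -
  have "(\<Sum>e\<in>E. \<Sum>v\<in>e. g v) = (\<Sum>e\<in>E. \<Sum>v | v \<in> V \<and> v \<in> e. g v)"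
    using assms by (intro sum.cong refl) (metis (no_types, lifting) Collect_mem_eq Collect_cong subsetD)
  also have "\<dots> = (\<Sum>v\<in>V. \<Sum>e | e \<in> E \<and> v \<in> e. g v)"
    using assms by (intro sum.swap_restrict) auto
  finally show ?thesis by (simp add: vertex_degree_def)
qed

text \<open>
Positivity of the kernel at the indicator of \<open>E\<close>. Disjoint pairs do not occur in \<open>E\<close>, and
double counting turns the sum of \<open>|F \<inter> G|\<close> over all pairs of edges into the sum of the squared
degrees.
\<close>

lemma intersecting_degree_square_bound:
  fixes V :: "'a set" and k n :: nat
  assumes V: "finite V" "card V = n" and k: "2 \<le> k" and n: "2 * k + 1 \<le> n"
    and E: "E \<subseteq> ksets k V" and int: "\<And>e f. e \<in> E \<Longrightarrow> f \<in> E \<Longrightarrow> e \<inter> f \<noteq> {}"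
  shows "real n * (real k - 1) / (real n - 1) * (real (card E))\<^sup>2
    \<le> (\<Sum>v\<in>V. (real (vertex_degree E v))\<^sup>2) + (real k - 2) * ((n - 2) choose (k - 1)) * card E"
proof -
  define a where "a = real ((n - 2) choose (k - 1))"
  define s where "s = (real k - 1) * a / real ((n - k - 1) choose (k - 1))"
  let ?\<mu> = "(real k - 2) * a" and ?c = "- real n * (real k - 1) / (real n - 1)"
  let ?K = "scheme_kernel s ?\<mu> 1 ?c :: 'a set \<Rightarrow> 'a set \<Rightarrow> real"
  let ?f = "\<lambda>F. of_bool (F \<in> E) :: real"
  have fin: "finite (ksets k V)" "finite E" using V E by (auto simp: finite_ksets intro: finite_subset)
  have subV: "e \<subseteq> V" if "e \<in> E" for e using E that by (auto simp: ksets_def)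
  have "0 \<le> quad ?K (ksets k V) ?f"
  proof (rule ccontr)
    assume "\<not> 0 \<le> quad ?K (ksets k V) ?f"
    then have neg: "quad ?K (ksets k V) ?f < 0" by simp
    obtain \<theta> g where \<theta>: "\<theta> < 0" and g: "eigenvector ?K (ksets k V) \<theta> g"
      using negative_form_has_negative_eigenvector[OF fin(1) _ neg] kernel_sym by metis
    have "0 \<le> \<theta>"
      by (rule kernel_eigenvalue_nonneg[OF V k n g[unfolded s_def a_def]])
    with \<theta> show False by simp
  qed
  also have "quad ?K (ksets k V) ?f = (\<Sum>F\<in>E. \<Sum>G\<in>E. ?K F G)"
  proof -
    have restrict: "(\<Sum>G\<in>ksets k V. h G * ?f G) = (\<Sum>G\<in>E. h G)" for h :: "'a set \<Rightarrow> real"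
      using fin E by (intro sum.mono_neutral_cong_right) auto
    have "quad ?K (ksets k V) ?f = (\<Sum>F\<in>ksets k V. (\<Sum>G\<in>ksets k V. ?K F G * ?f G) * ?f F)"
      unfolding quad_def sum_distrib_right by (intro sum.cong refl) (simp only: mult_ac)
    then show ?thesis by (simp only: restrict)
  qed
  also have "\<dots> = (\<Sum>F\<in>E. ?\<mu> + real (\<Sum>v\<in>F. vertex_degree E v) + ?c * card E)"
  proof (intro sum.cong refl)
    fix F assume F: "F \<in> E"
    then have "finite F" using subV V finite_subset by blast
    have "(\<Sum>G\<in>E. ?K F G) = (\<Sum>G\<in>E. ?\<mu> * (of_bool (F = G) * 1) + real (card (F \<inter> G)) + ?c)"
      using F int by (intro sum.cong refl) (simp add: scheme_kernel_def)
    also have "\<dots> = ?\<mu> * (\<Sum>G\<in>E. of_bool (F = G) * 1) + real (\<Sum>G\<in>E. card (F \<inter> G)) + card E * ?c"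
      by (simp only: sum.distrib sum_distrib_left sum_constant of_nat_sum)
    also have "\<dots> = ?\<mu> + real (\<Sum>v\<in>F. vertex_degree E v) + ?c * card E"
      unfolding sum_of_bool_eq_mult[OF fin(2) F] sum_card_Int[OF fin(2) \<open>finite F\<close>] vertex_degree_def
      by simp
    finally show "(\<Sum>G\<in>E. ?K F G) = ?\<mu> + real (\<Sum>v\<in>F. vertex_degree E v) + ?c * card E" .
  qed
  also have "\<dots> = ?\<mu> * card E + (\<Sum>F\<in>E. \<Sum>v\<in>F. real (vertex_degree E v)) + ?c * (real (card E))\<^sup>2"
    by (simp only: sum.distrib sum_constant of_nat_sum power2_eq_square mult_ac)
  also have "(\<Sum>F\<in>E. \<Sum>v\<in>F. real (vertex_degree E v)) = (\<Sum>v\<in>V. (real (vertex_degree E v))\<^sup>2)"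
    using sum_edges_sum_vertices[OF V(1) fin(2) subV] by (simp add: power2_eq_square)
  finally show ?thesis by (simp add: a_def)
qed

text \<open>
The algebra that completes the square. Here \<open>S\<close> stands for the sum of the squared degrees and
\<open>k * m\<close> for the sum of the degrees, so that the first bracket is the sum of
\<open>(d v - \<delta>) * (M - d v)\<close>.
\<close>

lemma degree_deficit_identity:
  fixes k n m M \<delta> S :: real
  assumes n: "n > 1" and \<delta>: "(n - 1) * \<delta> = (k - 1) * M"
  shows "((M + \<delta>) * (k * m) - n * M * \<delta> - S) + n * (k - 1) / (n - 1) * (m - M)\<^sup>2
    = n * (k - 1) / (n - 1) * m\<^sup>2 - (S + (k - 2) * (M - \<delta>) * m)"
proof -
  have d: "\<delta> = (k - 1) * M / (n - 1)" using n \<delta> by (simp add: field_simps)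
  show ?thesis unfolding d using n
    by (simp add: divide_simps) (simp add: algebra_simps power2_eq_square)
qed

theorem theorem1p1:
  fixes k n :: nat and V :: "'a set" and E :: "'a set set"
  assumes "k \<ge> 2" and "n \<ge> 2 * k + 1"
    and "uniform_hypergraph k V E" and "card V = n"
    and "\<forall>v\<in>V. vertex_degree E v \<ge> (n - 2) choose (k - 2)"
  shows "one_star k V E \<or> (\<exists>e\<in>E. \<exists>f\<in>E. e \<noteq> f \<and> e \<inter> f = {})"
proof (rule disjCI)
  assume no_disjoint: "\<not> (\<exists>e\<in>E. \<exists>f\<in>E. e \<noteq> f \<and> e \<inter> f = {})"
  have V: "finite V" and E: "E \<subseteq> ksets k V"
    using assms(3) by (auto simp: uniform_hypergraph_def ksets_def)
  have finE: "finite E" using E V finite_ksets finite_subset by blast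
  have int: "e \<inter> f \<noteq> {}" if "e \<in> E" "f \<in> E" for e f
    using that no_disjoint E assms(1) by (cases "e = f") (auto simp: ksets_def)
  define \<delta> M where "\<delta> = real ((n - 2) choose (k - 2))" and "M = (n - 1) choose (k - 1)"
  define m where "m = real (card E)"
  define d where "d v = real (vertex_degree E v)" for v
  let ?gap = "\<Sum>v\<in>V. (d v - \<delta>) * (real M - d v)"
  let ?c = "real n * (real k - 1) / (real n - 1)"
  have star_card: "card {e \<in> ksets k V. v \<in> e} = M" if "v \<in> V" for v
    using card_ksets_containing[OF V that, of "k - 1"] assms(1,4) by (simp add: M_def)
  have d_le: "d v \<le> M" if "v \<in> V" for v
  proof -
    have "card {e \<in> E. v \<in> e} \<le> card {e \<in> ksets k V. v \<in> e}"
      using E V by (intro card_mono) (auto simp: finite_ksets)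
    then show ?thesis using star_card[OF that] by (simp add: d_def vertex_degree_def)
  qed
  have d_ge: "\<delta> \<le> d v" if "v \<in> V" for v
    using assms(5) that by (simp add: \<delta>_def d_def)
  have pascal: "real ((n - 2) choose (k - 1)) = M - \<delta>"
  proof -
    have "M = ((n - 2) choose (k - 2)) + ((n - 2) choose (k - 1))"
      using binomial_Suc_Suc[of "n - 2" "k - 2"] assms(1,2) by (simp add: M_def Suc_diff_Suc numeral_2_eq_2)
    then show ?thesis by (simp add: \<delta>_def)
  qed
  have \<delta>M: "(real n - 1) * \<delta> = (real k - 1) * M"
  proof -
    have "(k - 1) * M = (n - 1) * ((n - 2) choose (k - 2))"
      using times_binomial_minus1_eq[of "k - 1" "n - 1"] assms(1) by (simp add: M_def numeral_2_eq_2)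
    then have "real (k - 1) * M = real (n - 1) * \<delta>"
      unfolding \<delta>_def by (metis of_nat_mult)
    then show ?thesis using assms(1,2) by (simp add: of_nat_diff)
  qed
  have sum_d: "(\<Sum>v\<in>V. d v) = k * m"
  proof -
    have "e \<subseteq> V" if "e \<in> E" for e using E that by (auto simp: ksets_def)
    then have "(\<Sum>v\<in>V. d v) = (\<Sum>e\<in>E. \<Sum>v\<in>e. 1)"
      using sum_edges_sum_vertices[OF V finE, of "\<lambda>_. 1"] by (simp add: d_def)
    also have "\<dots> = (\<Sum>e\<in>E. real k)"
      using E by (intro sum.cong) (auto simp: ksets_def)
    finally show ?thesis by (simp add: m_def)
  qed
  have "?gap = (\<Sum>v\<in>V. (M + \<delta>) * d v - M * \<delta> - (d v)\<^sup>2)"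
    by (intro sum.cong) (auto simp: algebra_simps power2_eq_square)
  also have "\<dots> = (M + \<delta>) * (k * m) - real n * M * \<delta> - (\<Sum>v\<in>V. (d v)\<^sup>2)"
    by (simp add: sum_subtractf assms(4) flip: sum_distrib_left sum_d)
  finally have gap_eq: "?gap = (M + \<delta>) * (k * m) - real n * M * \<delta> - (\<Sum>v\<in>V. (d v)\<^sup>2)" .
  have "?gap + ?c * (m - M)\<^sup>2 = ?c * m\<^sup>2 - ((\<Sum>v\<in>V. (d v)\<^sup>2) + (real k - 2) * (M - \<delta>) * m)"
    unfolding gap_eq by (rule degree_deficit_identity[OF _ \<delta>M]) (use assms(1,2) in simp)
  also have "\<dots> \<le> 0"
    using intersecting_degree_square_bound[OF V assms(4,1,2) E int] pascal
    by (simp add: m_def d_def)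
  finally have le: "?gap + ?c * (m - M)\<^sup>2 \<le> 0" .
  have gap_term: "0 \<le> (d v - \<delta>) * (real M - d v)" if "v \<in> V" for v
    using d_ge[OF that] d_le[OF that] by simp
  have gap: "0 \<le> ?gap" using gap_term by (rule sum_nonneg)
  have c: "?c > 0" using assms(1,2) by simp
  then have sq: "0 \<le> ?c * (m - M)\<^sup>2" by (intro mult_nonneg_nonneg) auto
  have "?c * (m - M)\<^sup>2 = 0" and gap0: "?gap = 0" using le gap sq by linarith+
  then have m: "m = M" using c by (metis eq_iff_diff_eq_0 less_irrefl mult_eq_0_iff power_eq_0_iff)
  have extreme: "d v = \<delta> \<or> d v = M" if "v \<in> V" for v
    using gap0 gap_term that V by (auto simp: sum_nonneg_eq_0_iff)
  \<comment> \<open>If all degrees were \<open>\<delta>\<close>, their sum \<open>k * M\<close> would be \<open>n * \<delta>\<close>, but \<open>k * M - n * \<delta> = M - \<delta> > 0\<close>.\<close>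
  have "\<exists>v\<in>V. d v = M"
  proof (rule ccontr)
    assume "\<not> (\<exists>v\<in>V. d v = M)"
    then have "(\<Sum>v\<in>V. d v) = n * \<delta>" using extreme assms(4) by simp
    then have "real k * M = n * \<delta>" using sum_d m by simp
    with \<delta>M have "M - \<delta> = 0" by (simp add: algebra_simps)
    moreover have "(n - 2) choose (k - 1) > 0" using assms(1,2) by simp
    ultimately show False using pascal by simp
  qed
  then obtain v where v: "v \<in> V" "d v = M" by blast
  have "{e \<in> E. v \<in> e} = E"
    using v m finE by (intro card_subset_eq) (auto simp: d_def m_def vertex_degree_def)
  moreover have "{e \<in> E. v \<in> e} = {e \<in> ksets k V. v \<in> e}"
    using E v V star_card[OF v(1)]
    by (intro card_subset_eq) (auto simp: d_def vertex_degree_def finite_ksets)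
  ultimately have "E = {e \<in> ksets k V. v \<in> e}" by simp
  then show "one_star k V E"
    using v by (auto simp: one_star_def ksets_def)
qed

end
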